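(* For every fixed $\theta\in\mathcal B$ with $C^\theta\ge0$, $$0\le\mathrm{OPT}_{\mathrm{LP}}(\theta)-\mathrm{OPT}_{\mathrm{IP}}(\theta)\le\Delta V_{\max}^\theta,$$ where $\mathrm{OPT}_{\mathrm{LP}}(\theta)$ and $\mathrm{OPT}_{\mathrm{IP}}(\theta)$ are the optimal values of the LP relaxation of the fixed-$\theta$ MCKP and of the fixed-$\theta$ MCKP, respectively.
   Context: Data. There are items $i=1,\dots,n$. Item $i$ has a finite price menu $\mathcal X_i=\{x_{i,1},\dots,x_{i,m}\}\subset\mathbb R$, a reference price $a_i>0$, an exposure $\omega_i>0$, a nominal demand function $\hat g_i:\mathcal X_i\to\mathbb R_{>0}$ (monotone decreasing on the admissible range), and a relative tolerance $\sigma_i$. A margin target $\Delta>0$ and an integer budget $\Gamma\in\{0,1,\dots,n\}$ are given. The admissible menu $\mathcal X_i^{\mathrm{ad}}=\mathcal X_i\cap[(1-\sigma_i)a_i,(1+\sigma_i)a_i]$ is assumed nonempty. A variability parameter $\delta_i(x_i)$ is given with $0\le\delta_i(x_i)<\hat g_i(x_i)$ on $\mathcal X_i^{\mathrm{ad}}$. All option indices $j$ below range over admissible options of item $i$. Fixed-$\theta$ MCKP. Put $v_{ij}=\omega_i x_{i,j}\hat g_i(x_{i,j})$, $s_{ij}=\omega_i(x_{i,j}-\Delta a_i)\hat g_i(x_{i,j})$, $t_{ij}=\omega_i(x_{i,j}-\Delta a_i)\delta_i(x_{i,j})$, and $\mathcal B=\{0\}\cup\{|t_{ij}|: x_{i,j}\in\mathcal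 X_i^{\mathrm{ad}}\}$. For $\theta\in\mathcal B$ let $s^\theta_{ij}=s_{ij}-\max\{0,|t_{ij}|-\theta\}$, choose $j^\theta(i)\in\arg\max_j s^\theta_{ij}$, and set $c^\theta_{ij}=s^\theta_{i,j^\theta(i)}-s^\theta_{ij}\ge0$ and $C^\theta=\sum_i s^\theta_{i,j^\theta(i)}-\Gamma\theta$. The fixed-$\theta$ MCKP is: choose one admissible option $j(i)$ per item to maximize $\sum_i v_{i,j(i)}$ subject to $\sum_i c^\theta_{i,j(i)}\le C^\theta$. Its LP relaxation uses variables $z_{ij}\ge0$, $\sum_j z_{ij}=1$ for each $i$, with objective $\sum_{i,j}v_{ij}z_{ij}$ and constraint $\sum_{i,j}c^\theta_{ij}z_{ij}\le C^\theta$. Upper hulls. Let $\mathcal P_i^\theta=\{(c^\theta_{ij},v_{ij})\}_j$. Discard dominated points ($(c',v')$ is discarded if another point $(c,v)$ has $c\le c'$, $v\ge v'$; for equal costs only the largest value is kept). Let $\mathcal H_i^\theta=\{(c^{H,\theta}_{i,1},v^{H,\theta}_{i,1}),\dots,(c^{H,\theta}_{i,p_i},v^{H,\theta}_{i,p_i})\}$ be the vertices of the resulting upper hull (efficient concave upper frontier), ordered by strictly increasing cost. Define $$\Delta V_{\max}^\theta=\max_i\max_{k=1,\dots,p_i-1}\big(v^{H,\theta}_{i,k+1}-v^{H,\theta}_{i,k}\big)\ge0,$$ with $\max_{k\in\emptyset}(\cdot)=0$ when $p_i=1$. *)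

theory Defs
  imports "HOL-Analysis.Analysis"
begin

section \<open>Data\<close>

text \<open>
  Items are \<open>1, \<dots>, items\<close> and options are \<open>1, \<dots>, options\<close>.  The menu of item \<open>i\<close> is the set of
  the prices \<open>price i j\<close>; repetitions in this enumeration are allowed.  Only \<open>demand i\<close> on the menu
  of \<open>i\<close> and \<open>variability i\<close> on its admissible menu matter.
\<close>

record pricing_data =
  items :: nat
  options :: nat
  price :: "nat \<Rightarrow> nat \<Rightarrow> real"
  ref_price :: "nat \<Rightarrow> real"
  exposure :: "nat \<Rightarrow> real"
  demand :: "nat \<Rightarrow> real \<Rightarrow> real"
  tolerance :: "nat \<Rightarrow> real"
  variability :: "nat \<Rightarrow> real \<Rightarrow> real"
  margin :: real
  budget :: nat

definition menu :: "pricing_data \<Rightarrow> nat \<Rightarrow> real set" where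
  "menu D i = price D i ` {1..options D}"

definition admissible_menu :: "pricing_data \<Rightarrow> nat \<Rightarrow> real set" where
  "admissible_menu D i =
     menu D i \<inter> {(1 - tolerance D i) * ref_price D i .. (1 + tolerance D i) * ref_price D i}"

definition admissible_idx :: "pricing_data \<Rightarrow> nat \<Rightarrow> nat set" where
  "admissible_idx D i = {j \<in> {1..options D}. price D i j \<in> admissible_menu D i}"

definition valid_data :: "pricing_data \<Rightarrow> bool" where
  "valid_data D \<longleftrightarrow>
     margin D > 0 \<and> budget D \<le> items D \<and>
     (\<forall>i \<in> {1..items D}.
        ref_price D i > 0 \<and> exposure D i > 0 \<and>
        (\<forall>x \<in> menu D i. demand D i x > 0) \<and>
        monotone_on (admissible_menu D i) (\<le>) (\<ge>) (demand D i) \<and>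
        admissible_menu D i \<noteq> {} \<and>
        (\<forall>x \<in> admissible_menu D i. 0 \<le> variability D i x \<and> variability D i x < demand D i x))"

definition opt_value :: "pricing_data \<Rightarrow> nat \<Rightarrow> nat \<Rightarrow> real" where
  "opt_value D i j = exposure D i * price D i j * demand D i (price D i j)"

definition opt_slack :: "pricing_data \<Rightarrow> nat \<Rightarrow> nat \<Rightarrow> real" where
  "opt_slack D i j =
     exposure D i * (price D i j - margin D * ref_price D i) * demand D i (price D i j)"

definition opt_dev :: "pricing_data \<Rightarrow> nat \<Rightarrow> nat \<Rightarrow> real" where
  "opt_dev D i j =
     exposure D i * (price D i j - margin D * ref_price D i) * variability D i (price D i j)"

definition breakpoints :: "pricing_data \<Rightarrow> real set" where
  "breakpoints D = {0} \<union> {\<bar>opt_dev D i j\<bar> | i j. i \<in> {1..items D} \<and> j \<in> admissible_idx D i}"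

section \<open>The multiple-choice knapsack problem for fixed \<open>\<theta>\<close>\<close>

definition slack_at :: "pricing_data \<Rightarrow> real \<Rightarrow> nat \<Rightarrow> nat \<Rightarrow> real" where
  "slack_at D \<theta> i j = opt_slack D i j - max 0 (\<bar>opt_dev D i j\<bar> - \<theta>)"

text \<open>\<open>js i\<close> is the option \<open>j\<^sup>\<theta>(i)\<close>; it need not be the only maximizer.\<close>

definition slack_maximizers :: "pricing_data \<Rightarrow> real \<Rightarrow> (nat \<Rightarrow> nat) \<Rightarrow> bool" where
  "slack_maximizers D \<theta> js \<longleftrightarrow>
     (\<forall>i \<in> {1..items D}. is_arg_max (slack_at D \<theta> i) (\<lambda>j. j \<in> admissible_idx D i) (js i))"

definition cost :: "pricing_data \<Rightarrow> real \<Rightarrow> (nat \<Rightarrow> nat) \<Rightarrow> nat \<Rightarrow> nat \<Rightarrow> real" where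
  "cost D \<theta> js i j = slack_at D \<theta> i (js i) - slack_at D \<theta> i j"

definition capacity :: "pricing_data \<Rightarrow> real \<Rightarrow> (nat \<Rightarrow> nat) \<Rightarrow> real" where
  "capacity D \<theta> js = (\<Sum>i = 1..items D. slack_at D \<theta> i (js i)) - real (budget D) * \<theta>"

definition ip_feasible :: "pricing_data \<Rightarrow> real \<Rightarrow> (nat \<Rightarrow> nat) \<Rightarrow> (nat \<Rightarrow> nat) \<Rightarrow> bool" where
  "ip_feasible D \<theta> js ch \<longleftrightarrow>
     (\<forall>i \<in> {1..items D}. ch i \<in> admissible_idx D i) \<and>
     (\<Sum>i = 1..items D. cost D \<theta> js i (ch i)) \<le> capacity D \<theta> js"

definition ip_objective :: "pricing_data \<Rightarrow> (nat \<Rightarrow> nat) \<Rightarrow> real" where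
  "ip_objective D ch = (\<Sum>i = 1..items D. opt_value D i (ch i))"

definition lp_feasible :: "pricing_data \<Rightarrow> real \<Rightarrow> (nat \<Rightarrow> nat) \<Rightarrow> (nat \<Rightarrow> nat \<Rightarrow> real) \<Rightarrow> bool" where
  "lp_feasible D \<theta> js z \<longleftrightarrow>
     (\<forall>i \<in> {1..items D}. (\<forall>j \<in> admissible_idx D i. z i j \<ge> 0) \<and>
        (\<Sum>j \<in> admissible_idx D i. z i j) = 1) \<and>
     (\<Sum>i = 1..items D. \<Sum>j \<in> admissible_idx D i. cost D \<theta> js i j * z i j) \<le> capacity D \<theta> js"

definition lp_objective :: "pricing_data \<Rightarrow> (nat \<Rightarrow> nat \<Rightarrow> real) \<Rightarrow> real" where
  "lp_objective D z = (\<Sum>i = 1..items D. \<Sum>j \<in> admissible_idx D i. opt_value D i j * z i j)"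

text \<open>
  If the capacity is nonnegative, then both sets below are nonempty (take \<open>js\<close> itself) and bounded,
  and both suprema are attained.
\<close>

definition opt_ip :: "pricing_data \<Rightarrow> real \<Rightarrow> (nat \<Rightarrow> nat) \<Rightarrow> real" where
  "opt_ip D \<theta> js = Sup {ip_objective D ch | ch. ip_feasible D \<theta> js ch}"

definition opt_lp :: "pricing_data \<Rightarrow> real \<Rightarrow> (nat \<Rightarrow> nat) \<Rightarrow> real" where
  "opt_lp D \<theta> js = Sup {lp_objective D z | z. lp_feasible D \<theta> js z}"

section \<open>Upper hulls\<close>

text \<open>Points of the plane are pairs (cost, value).\<close>

definition undominated :: "(real \<times> real) set \<Rightarrow> (real \<times> real) set" where
  "undominated P = {p \<in> P. \<not> (\<exists>q \<in> P. q \<noteq> p \<and> fst q \<le> fst p \<and> snd q \<ge> snd p)}"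

definition upper_boundary :: "(real \<times> real) set \<Rightarrow> (real \<times> real) set" where
  "upper_boundary K = {p \<in> K. \<forall>q \<in> K. fst q = fst p \<longrightarrow> snd q \<le> snd p}"

definition hull_vertices :: "(real \<times> real) set \<Rightarrow> (real \<times> real) set" where
  "hull_vertices P =
     {p \<in> upper_boundary (convex hull (undominated P)).
        p extreme_point_of (convex hull (undominated P))}"

definition hull_list :: "(real \<times> real) set \<Rightarrow> (real \<times> real) list" where
  "hull_list P =
     (THE ps. set ps = hull_vertices P \<and> sorted_wrt (\<lambda>p q. fst p < fst q) ps)"

lemma undominatedD:
  assumes "p \<in> undominated P" "q \<in> P" "fst q \<le> fst p" "snd p \<le> snd q"
  shows "q = p"
  using assms unfolding undominated_def by blast

lemma hull_vertices_subset: "hull_vertices P \<subseteq> undominated P"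
  by (auto simp: hull_vertices_def dest: extreme_point_of_convex_hull)

lemma ex1_list_sorted_by_fst:
  fixes S :: "(real \<times> real) set"
  assumes "finite S" "inj_on fst S"
  shows "\<exists>!ps. set ps = S \<and> sorted_wrt (\<lambda>p q. fst p < fst q) ps"
proof
  let ?f = "the_inv_into S fst"
  let ?cs = "sorted_list_of_set (fst ` S)"
  have f: "fst (?f c) = c" "?f c \<in> S" if "c \<in> fst ` S" for c
    using that assms(2) by (auto simp: f_the_inv_into_f the_inv_into_into)
  have "?f ` fst ` S = S"
    using the_inv_into_onto[OF assms(2)] by simp
  then have "set (map ?f ?cs) = S"
    using assms(1) by simp
  moreover have "sorted_wrt (\<lambda>p q. fst p < fst q) (map ?f ?cs)"
    unfolding sorted_wrt_map
    by (rule sorted_wrt_mono_rel[OF _ strict_sorted_list_of_set]) (use assms f in auto)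
  ultimately show "set (map ?f ?cs) = S \<and> sorted_wrt (\<lambda>p q. fst p < fst q) (map ?f ?cs)"
    by blast
  fix ps assume ps: "set ps = S \<and> sorted_wrt (\<lambda>p q. fst p < fst q) ps"
  then have "sorted_wrt (<) (map fst ps)" "set (map fst ps) = fst ` S"
    by (auto simp: sorted_wrt_map)
  then have "map fst ps = ?cs"
    using strict_sorted_equal[of "map fst ps" ?cs] assms by simp
  moreover have "map ?f (map fst ps) = ps"
    unfolding map_map by (rule map_idI) (use ps assms(2) in \<open>auto simp: the_inv_into_f_f\<close>)
  ultimately show "ps = map ?f ?cs"
    by metis
qed

lemma hull_list:
  assumes "finite P"
  shows "set (hull_list P) = hull_vertices P"
    and "sorted_wrt (\<lambda>p q. fst p < fst q) (hull_list P)"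
proof -
  have "inj_on fst (undominated P)"
  proof (rule inj_onI)
    fix p q assume pq: "p \<in> undominated P" "q \<in> undominated P" "fst p = fst q"
    then have "p \<in> P" "q \<in> P"
      unfolding undominated_def by blast+
    from linear[of "snd p" "snd q"] show "p = q"
    proof
      assume "snd p \<le> snd q"
      then show ?thesis
        using undominatedD[OF pq(1) \<open>q \<in> P\<close>] pq(3) by simp
    next
      assume "snd q \<le> snd p"
      then show ?thesis
        using undominatedD[OF pq(2) \<open>p \<in> P\<close>] pq(3) by simp
    qed
  qed
  moreover have "finite (undominated P)"
    using assms by (auto simp: undominated_def)
  ultimately have "finite (hull_vertices P)" "inj_on fst (hull_vertices P)"
    using finite_subset[OF hull_vertices_subset] inj_on_subset[OF _ hull_vertices_subset] by blast+
  from theI'[OF ex1_list_sorted_by_fst[OF this]]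
  show "set (hull_list P) = hull_vertices P"
    and "sorted_wrt (\<lambda>p q. fst p < fst q) (hull_list P)"
    by (simp_all add: hull_list_def)
qed

definition item_points :: "pricing_data \<Rightarrow> real \<Rightarrow> (nat \<Rightarrow> nat) \<Rightarrow> nat \<Rightarrow> (real \<times> real) set" where
  "item_points D \<theta> js i = (\<lambda>j. (cost D \<theta> js i j, opt_value D i j)) ` admissible_idx D i"

definition Max0 :: "real set \<Rightarrow> real" where
  "Max0 A = (if A = {} then 0 else Max A)"

text \<open>List positions start at 0, hence the steps between neighbouring vertices have \<open>k + 1 < length\<close>.\<close>

definition max_step :: "(real \<times> real) list \<Rightarrow> real" where
  "max_step ps = Max0 {snd (ps ! (k + 1)) - snd (ps ! k) | k. k + 1 < length ps}"

definition max_value_gap :: "pricing_data \<Rightarrow> real \<Rightarrow> (nat \<Rightarrow> nat) \<Rightarrow> real" where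
  "max_value_gap D \<theta> js = Max0 ((\<lambda>i. max_step (hull_list (item_points D \<theta> js i))) ` {1..items D})"

end

theory Submission
  imports Defs
begin

text \<open>
  The proof compares both optima with the Lagrangian relaxation of the capacity constraint.  For a
  multiplier \<open>\<mu> \<ge> 0\<close>, every fractional solution has value at most
  \<open>L \<mu> = \<mu> * C + (\<Sum>i. max over the points (c, v) of item i of v - \<mu> * c)\<close>
  (\<open>lp_objective_le_lagrangian_bound\<close>).  So it suffices to find one \<open>\<mu>\<close> and one integral solution
  whose value is within the maximal hull step of \<open>L \<mu>\<close>.

  Choose \<open>\<mu>\<close> as a minimizer of \<open>L\<close> over a long enough interval that starts at \<open>0\<close>.  For each item
  let \<open>l i\<close> and \<open>r i\<close> be the maximizers of \<open>v - \<mu> * c\<close> with the least and the greatest cost.  The right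
  derivative of \<open>L\<close> at \<open>\<mu>\<close> is \<open>C - (\<Sum>i. cost of l i)\<close>, and the left derivative is
  \<open>C - (\<Sum>i. cost of r i)\<close>; minimality gives them their signs, so for \<open>\<mu> > 0\<close> the capacity lies
  between the two total costs (\<open>balanced_multiplier_exists\<close>).
  Now start from all the \<open>l i\<close> and exchange them for the \<open>r i\<close> one item after the other, and stop
  before the first exchange, say of item \<open>k\<close>, that exceeds the capacity.  The solution reached is
  feasible, and it consists of maximizers, so it misses \<open>L \<mu>\<close> by exactly \<open>\<mu>\<close> times its unused
  capacity.  That is at most \<open>\<mu> * (cost of r k - cost of l k)\<close>, which equals the value of \<open>r k\<close>
  minus the value of \<open>l k\<close> because both points maximize \<open>v - \<mu> * c\<close> (\<open>lagrangian_rounding\<close>).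

  Finally, \<open>l k\<close> and \<open>r k\<close> are the ends of one edge of the upper hull of item \<open>k\<close>.  They are vertices,
  as each becomes the only maximizer when \<open>\<mu>\<close> is slightly changed, and they are neighbours, as a
  vertex strictly between them would lie on the segment that joins them
  (\<open>tie_broken_maximizers_step\<close>).  Hence the loss is at most one of the hull steps.

  Two cases leave no loss at all: if \<open>\<mu> = 0\<close>, unused capacity has no price, and if \<open>\<mu> > 0\<close> but no
  exchange exceeds the capacity, then the total cost of the \<open>r i\<close> equals it.
\<close>

section \<open>Points priced by a multiplier\<close>

definition reduced_value :: "real \<Rightarrow> real \<times> real \<Rightarrow> real" where
  "reduced_value \<mu> p = snd p - \<mu> * fst p"

definition best_reduced :: "real \<Rightarrow> (real \<times> real) set \<Rightarrow> real" where
  "best_reduced \<mu> P = Max (reduced_value \<mu> ` P)"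

text \<open>
  Ties are broken towards low costs for \<open>d = 1\<close> and towards high costs for \<open>d = - 1\<close>: the chosen
  point is the one that stays optimal when \<open>\<mu>\<close> moves slightly in the direction \<open>d\<close>.  The sign as a
  parameter lets one argument serve both ends of a hull edge and both one-sided derivatives.
\<close>

definition tie_broken_maximizer ::
  "real \<Rightarrow> real \<Rightarrow> (real \<times> real) set \<Rightarrow> real \<times> real \<Rightarrow> bool" where
  "tie_broken_maximizer d \<mu> P l \<longleftrightarrow>
     l \<in> P \<and> (\<forall>p \<in> P - {l}. reduced_value \<mu> p < reduced_value \<mu> l \<or>
       (reduced_value \<mu> p = reduced_value \<mu> l \<and> d * fst l < d * fst p))"

lemma reduced_value_shift:
  "reduced_value (\<mu> + h) p = reduced_value \<mu> p - h * fst p"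
  by (simp add: reduced_value_def algebra_simps)

lemma reduced_value_combination:
  "reduced_value \<mu> (a *\<^sub>R p + b *\<^sub>R q) = a * reduced_value \<mu> p + b * reduced_value \<mu> q"
  by (simp add: reduced_value_def algebra_simps)

lemma reduced_value_le_best:
  assumes "finite P" "p \<in> P"
  shows "reduced_value \<mu> p \<le> best_reduced \<mu> P"
  using assms by (simp add: best_reduced_def)

lemma best_reduced_eqI:
  assumes "finite P" "l \<in> P" "\<And>p. p \<in> P \<Longrightarrow> reduced_value \<mu> p \<le> reduced_value \<mu> l"
  shows "best_reduced \<mu> P = reduced_value \<mu> l"
  unfolding best_reduced_def using assms by (intro Max_eqI) auto

lemma best_reduced_tie_broken:
  assumes "finite P" "tie_broken_maximizer d \<mu> P l"
  shows "best_reduced \<mu> P = reduced_value \<mu> l"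
proof (rule best_reduced_eqI[OF assms(1)])
  show "reduced_value \<mu> p \<le> reduced_value \<mu> l" if "p \<in> P" for p
    using assms(2) that unfolding tie_broken_maximizer_def
    by (metis DiffI empty_iff insert_iff order.strict_implies_order order.refl)
qed (use assms(2) in \<open>simp add: tie_broken_maximizer_def\<close>)

lemma tie_broken_maximizer_exists:
  assumes "finite P" "P \<noteq> {}" "d \<noteq> 0"
  shows "\<exists>l. tie_broken_maximizer d \<mu> P l"
proof -
  define A where "A = {p \<in> P. reduced_value \<mu> p = best_reduced \<mu> P}"
  have "best_reduced \<mu> P \<in> reduced_value \<mu> ` P"
    unfolding best_reduced_def using assms by (intro Max_in) auto
  then obtain p where "p \<in> P" "reduced_value \<mu> p = best_reduced \<mu> P"
    by (metis imageE)
  then have A: "finite A" "A \<noteq> {}"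
    unfolding A_def using assms(1) by (simp, blast)
  define l where "l = arg_min_on (\<lambda>p. d * fst p) A"
  have l: "l \<in> A" "\<And>p. p \<in> A \<Longrightarrow> d * fst l \<le> d * fst p"
    unfolding l_def using A by (auto intro: arg_min_if_finite(1) arg_min_least)
  have "reduced_value \<mu> p < reduced_value \<mu> l \<or>
      (reduced_value \<mu> p = reduced_value \<mu> l \<and> d * fst l < d * fst p)"
    if p: "p \<in> P" "p \<noteq> l" for p
  proof (cases "p \<in> A")
    case True
    then have tie: "reduced_value \<mu> p = reduced_value \<mu> l"
      using l(1) by (simp add: A_def)
    have "fst p \<noteq> fst l"
      using tie p(2) by (auto simp: reduced_value_def prod_eq_iff)
    then show ?thesis
      using tie l(2)[OF True] \<open>d \<noteq> 0\<close> by (simp add: less_le)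
  next
    case False
    then show ?thesis
      using l(1) p(1) reduced_value_le_best[OF assms(1) p(1), of \<mu>]
      by (simp add: A_def less_le)
  qed
  then have "tie_broken_maximizer d \<mu> P l"
    using l(1) unfolding tie_broken_maximizer_def A_def by blast
  then show ?thesis ..
qed

text \<open>
  A strict advantage survives a small change of the multiplier by continuity, and a tie is decided by
  the costs, in the direction of the tie-breaking.
\<close>

lemma eventually_unique_maximizer:
  assumes "finite P" "tie_broken_maximizer d \<mu> P l"
  shows "\<forall>\<^sub>F \<epsilon> in at_right 0.
    \<forall>p \<in> P - {l}. reduced_value (\<mu> + d * \<epsilon>) p < reduced_value (\<mu> + d * \<epsilon>) l"
proof (rule eventually_ball_finite)
  show "\<forall>p \<in> P - {l}. \<forall>\<^sub>F \<epsilon> in at_right 0.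
      reduced_value (\<mu> + d * \<epsilon>) p < reduced_value (\<mu> + d * \<epsilon>) l"
  proof
    fix p assume "p \<in> P - {l}"
    then consider "reduced_value \<mu> p < reduced_value \<mu> l"
      | "reduced_value \<mu> p = reduced_value \<mu> l" "d * fst l < d * fst p"
      using assms(2) by (auto simp: tie_broken_maximizer_def)
    then show "\<forall>\<^sub>F \<epsilon> in at_right 0.
        reduced_value (\<mu> + d * \<epsilon>) p < reduced_value (\<mu> + d * \<epsilon>) l"
    proof cases
      case 1
      have "((\<lambda>\<epsilon>. reduced_value (\<mu> + d * \<epsilon>) l - reduced_value (\<mu> + d * \<epsilon>) p) \<longlongrightarrow>
          reduced_value (\<mu> + d * 0) l - reduced_value (\<mu> + d * 0) p) (at_right 0)"
        unfolding reduced_value_def by (intro tendsto_intros)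
      then show ?thesis
        by (rule order_tendstoD(1)[where a = 0, THEN eventually_mono]) (use 1 in simp_all)
    next
      case 2
      show ?thesis
        using eventually_at_right_less[of "0::real"]
      proof eventually_elim
        case (elim \<epsilon>)
        then have "\<epsilon> * (d * fst l) < \<epsilon> * (d * fst p)"
          using 2(2) by simp
        then show ?case
          unfolding reduced_value_shift using 2(1) by (simp add: mult_ac)
      qed
    qed
  qed
qed (use assms(1) in simp)

text \<open>
  The maximum is a piecewise linear function of the multiplier, and its slope on the side \<open>d\<close> of
  \<open>\<mu>\<close> is the negated cost of the point that stays optimal on that side.
\<close>

lemma eventually_best_reduced:
  assumes "finite P" "tie_broken_maximizer d \<mu> P l"
  shows "\<forall>\<^sub>F \<epsilon> in at_right 0.
    best_reduced (\<mu> + d * \<epsilon>) P = best_reduced \<mu> P - d * \<epsilon> * fst l"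
  using eventually_unique_maximizer[OF assms]
proof eventually_elim
  case (elim \<epsilon>)
  have "best_reduced (\<mu> + d * \<epsilon>) P = reduced_value (\<mu> + d * \<epsilon>) l"
  proof (rule best_reduced_eqI[OF assms(1)])
    show "reduced_value (\<mu> + d * \<epsilon>) p \<le> reduced_value (\<mu> + d * \<epsilon>) l" if "p \<in> P" for p
      using elim that by (cases "p = l") (auto simp: less_imp_le)
  qed (use assms(2) in \<open>simp add: tie_broken_maximizer_def\<close>)
  then show ?case
    by (simp add: best_reduced_tie_broken[OF assms] reduced_value_shift)
qed

lemma continuous_on_best_reduced:
  assumes "finite P" "P \<noteq> {}"
  shows "continuous_on A (\<lambda>\<mu>. best_reduced \<mu> P)"
  using assms
proof (induction P rule: finite_ne_induct)
  case (singleton p)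
  then show ?case
    unfolding best_reduced_def reduced_value_def by (auto intro!: continuous_intros)
next
  case (insert p P)
  have "best_reduced \<mu> (insert p P) = max (reduced_value \<mu> p) (best_reduced \<mu> P)" for \<mu>
    unfolding best_reduced_def using insert.hyps by simp
  moreover have "continuous_on A (\<lambda>\<mu>. reduced_value \<mu> p)"
    unfolding reduced_value_def by (intro continuous_intros)
  ultimately show ?case
    using insert.IH by (auto intro!: continuous_on_max)
qed

section \<open>Steps of the upper hull\<close>

text \<open>
  A domination would transfer to the reduced values, as \<open>\<mu> \<ge> 0\<close>, so \<open>l\<close> is undominated.  All the other
  points lie in an open half-plane with \<open>l\<close> on its boundary line.  Adding \<open>l\<close> to this half-plane
  keeps it convex, so the hull meets the line in \<open>l\<close> alone.
\<close>

lemma unique_maximizer_in_hull_vertices: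
  assumes "0 \<le> \<mu>" "l \<in> P" "\<And>p. p \<in> P - {l} \<Longrightarrow> reduced_value \<mu> p < reduced_value \<mu> l"
  shows "l \<in> hull_vertices P"
proof -
  define U where "U = undominated P"
  define K where "K = insert l {x. reduced_value \<mu> x < reduced_value \<mu> l}"
  have "q = l" if "q \<in> P" "fst q \<le> fst l" "snd l \<le> snd q" for q
  proof (rule ccontr)
    assume "q \<noteq> l"
    then have "reduced_value \<mu> q < reduced_value \<mu> l"
      using assms(3) that(1) by simp
    then show False
      using that(3) mult_left_mono[OF that(2) assms(1)] by (simp add: reduced_value_def)
  qed
  then have "l \<in> U"
    using assms(2) by (auto simp: U_def undominated_def)
  have "convex K"
  proof (rule convexI)
    fix x y and a b :: real
    assume xy: "x \<in> K" "y \<in> K" and ab: "0 \<le> a" "0 \<le> b" "a + b = 1"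
    show "a *\<^sub>R x + b *\<^sub>R y \<in> K"
    proof (cases "a = 0 \<or> b = 0 \<or> (x = l \<and> y = l)")
      case True
      then show ?thesis
        using xy ab scaleR_left_distrib[of a b l] by (auto simp: K_def)
    next
      case False
      have "reduced_value \<mu> x \<le> reduced_value \<mu> l" "reduced_value \<mu> y \<le> reduced_value \<mu> l"
        using xy by (auto simp: K_def)
      moreover have "reduced_value \<mu> x < reduced_value \<mu> l \<or> reduced_value \<mu> y < reduced_value \<mu> l"
        using xy False by (auto simp: K_def)
      ultimately have "a * reduced_value \<mu> x + b * reduced_value \<mu> y
          < a * reduced_value \<mu> l + b * reduced_value \<mu> l"
        using ab False by (auto intro: add_less_le_mono add_le_less_mono)
      also have "\<dots> = reduced_value \<mu> l"
        using ab(3) by (metis distrib_right mult_1)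
      finally show ?thesis
        by (simp add: K_def reduced_value_combination)
    qed
  qed
  moreover have "U \<subseteq> K"
    using assms(3) by (auto simp: U_def K_def undominated_def)
  ultimately have hull: "convex hull U \<subseteq> K"
    by (intro hull_minimal)
  have l_hull: "l \<in> convex hull U"
    using \<open>l \<in> U\<close> by (rule hull_inc)
  have inner: "inner (- \<mu>, 1) x = reduced_value \<mu> x" for x :: "real \<times> real"
    by (cases x) (simp add: reduced_value_def)
  have "l extreme_point_of (convex hull U)"
  proof (rule extreme_point_of_Int_supporting_hyperplane_le)
    show "convex hull U \<inter> {x. inner (- \<mu>, 1) x = reduced_value \<mu> l} = {l}"
      using hull l_hull by (auto simp: inner K_def)
    show "inner (- \<mu>, 1) x \<le> reduced_value \<mu> l" if "x \<in> convex hull U" for x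
      using hull that by (auto simp: inner K_def)
  qed
  moreover have "l \<in> upper_boundary (convex hull U)"
    using hull l_hull by (auto simp: upper_boundary_def K_def reduced_value_def)
  ultimately show ?thesis
    by (simp add: hull_vertices_def U_def)
qed

lemma reduced_value_le_best_hull:
  assumes "finite P" "x \<in> convex hull (undominated P)"
  shows "reduced_value \<mu> x \<le> best_reduced \<mu> P"
proof -
  have "convex {x. reduced_value \<mu> x \<le> best_reduced \<mu> P}"
  proof (rule convexI)
    fix x y and a b :: real
    assume "x \<in> {x. reduced_value \<mu> x \<le> best_reduced \<mu> P}"
      "y \<in> {x. reduced_value \<mu> x \<le> best_reduced \<mu> P}" "0 \<le> a" "0 \<le> b" "a + b = 1"
    then show "a *\<^sub>R x + b *\<^sub>R y \<in> {x. reduced_value \<mu> x \<le> best_reduced \<mu> P}"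
      by (simp add: reduced_value_combination convex_bound_le)
  qed
  moreover have "undominated P \<subseteq> {x. reduced_value \<mu> x \<le> best_reduced \<mu> P}"
    using reduced_value_le_best[OF assms(1)] by (auto simp: undominated_def)
  ultimately show ?thesis
    using assms(2) hull_minimal[of "undominated P" _ convex] by blast
qed

text \<open>
  The line of maximal reduced value through \<open>l\<close> and \<open>r\<close> bounds the hull from above, and the segment
  from \<open>l\<close> to \<open>r\<close> is in the hull.  So a point of the upper boundary with a cost between theirs is an
  inner point of that segment and cannot be extreme.
\<close>

lemma not_vertex_between_maximizers:
  assumes "finite P" "l \<in> hull_vertices P" "r \<in> hull_vertices P" "m \<in> hull_vertices P"
    and "fst l < fst m" "fst m < fst r"
    and "reduced_value \<mu> l = best_reduced \<mu> P" "reduced_value \<mu> r = best_reduced \<mu> P"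
  shows False
proof -
  let ?K = "convex hull (undominated P)"
  define u where "u = (fst m - fst l) / (fst r - fst l)"
  have u: "0 < u" "u < 1" "u * (fst r - fst l) = fst m - fst l"
    using assms(5,6) by (auto simp: u_def field_simps)
  define w where "w = (1 - u) *\<^sub>R l + u *\<^sub>R r"
  have mem: "l \<in> ?K" "r \<in> ?K" "m \<in> ?K"
    using assms(2-4) by (auto simp: hull_vertices_def upper_boundary_def)
  have "w \<in> ?K"
    unfolding w_def using mem u convex_convex_hull[of "undominated P"] by (auto intro!: convexD)
  moreover have w1: "fst w = fst m"
    using u(3) by (simp add: w_def algebra_simps)
  ultimately have "snd w \<le> snd m"
    using assms(4) by (auto simp: hull_vertices_def upper_boundary_def)
  moreover have "reduced_value \<mu> w = best_reduced \<mu> P"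
    unfolding w_def reduced_value_combination using assms(7,8) by (simp add: algebra_simps)
  then have "snd m \<le> snd w"
    using reduced_value_le_best_hull[OF assms(1) mem(3), of \<mu>] w1 by (simp add: reduced_value_def)
  ultimately have "m = w"
    using w1 by (simp add: prod_eq_iff)
  moreover have "l \<noteq> r"
    using assms(5,6) by auto
  ultimately have "m \<in> open_segment l r"
    using u by (auto simp: w_def in_segment)
  then show False
    using assms(4) mem by (auto simp: hull_vertices_def extreme_point_of_def)
qed

lemma finite_steps: "finite {f (ps ! (k + 1)) (ps ! k) | k. k + 1 < length ps}"
proof -
  have "{f (ps ! (k + 1)) (ps ! k) | k. k + 1 < length ps} \<subseteq>
      (\<lambda>k. f (ps ! (k + 1)) (ps ! k)) ` {..<length ps}"
    by auto
  then show ?thesis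
    by (rule finite_subset) simp
qed

lemma Max0_ge: "finite A \<Longrightarrow> x \<in> A \<Longrightarrow> x \<le> Max0 A"
  by (auto simp: Max0_def)

lemma Max0_nonneg: "finite A \<Longrightarrow> (\<And>x. x \<in> A \<Longrightarrow> 0 \<le> x) \<Longrightarrow> 0 \<le> Max0 A"
  by (auto simp: Max0_def Max_ge_iff)

text \<open>
  The two tie-broken maximizers are the ends of the hull edge of slope \<open>\<mu>\<close>, that is, consecutive
  entries of the hull list.
\<close>

lemma tie_broken_maximizers_step:
  assumes "finite P" "0 < \<mu>"
    and l: "tie_broken_maximizer 1 \<mu> P l" and r: "tie_broken_maximizer (- 1) \<mu> P r"
    and "fst l < fst r"
  shows "snd r - snd l \<le> max_step (hull_list P)"
proof -
  let ?ps = "hull_list P"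
  have vertex: "q \<in> hull_vertices P" if q: "tie_broken_maximizer d \<mu> P q" for d q
  proof -
    \<comment> \<open>As \<open>0 < \<mu>\<close>, the multiplier can be changed in both directions and stay nonnegative.\<close>
    have "((\<lambda>\<epsilon>. \<mu> + d * \<epsilon>) \<longlongrightarrow> \<mu> + d * 0) (at_right 0)"
      by (intro tendsto_intros)
    then have "\<forall>\<^sub>F \<epsilon> in at_right 0. 0 < \<mu> + d * \<epsilon>"
      by (rule order_tendstoD(1)) (use \<open>0 < \<mu>\<close> in simp)
    from eventually_happens[OF eventually_conj[OF this eventually_unique_maximizer[OF \<open>finite P\<close> q]]]
    obtain \<epsilon> where "0 < \<mu> + d * \<epsilon>"
      "\<forall>p \<in> P - {q}. reduced_value (\<mu> + d * \<epsilon>) p < reduced_value (\<mu> + d * \<epsilon>) q"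
      by auto
    then show ?thesis
      using unique_maximizer_in_hull_vertices[of "\<mu> + d * \<epsilon>" q P] q
      by (auto simp: tie_broken_maximizer_def)
  qed
  have set_ps: "set ?ps = hull_vertices P" and sorted: "sorted_wrt (\<lambda>p q. fst p < fst q) ?ps"
    using hull_list[OF \<open>finite P\<close>] by blast+
  obtain a b where a: "a < length ?ps" "?ps ! a = l" and b: "b < length ?ps" "?ps ! b = r"
    using vertex[OF l] vertex[OF r] unfolding set_ps[symmetric] in_set_conv_nth by auto
  have mono: "fst (?ps ! x) < fst (?ps ! y)" if "x < y" "y < length ?ps" for x y
    using sorted that by (simp add: sorted_wrt_iff_nth_less)
  have "a < b"
  proof (rule ccontr)
    assume "\<not> a < b"
    then have "b < a \<or> a = b"
      by auto
    then show False
      using mono[of b a] a b assms(5) by auto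
  qed
  have "b = a + 1"
  proof (rule ccontr)
    assume "b \<noteq> a + 1"
    then have between: "a < a + 1" "a + 1 < b"
      using \<open>a < b\<close> by auto
    have "?ps ! (a + 1) \<in> hull_vertices P"
      using between b(1) nth_mem[of "a + 1" ?ps] set_ps by simp
    then show False
      using not_vertex_between_maximizers[OF \<open>finite P\<close> vertex[OF l] vertex[OF r]]
        mono[OF between(1)] mono[OF between(2) b(1)] between(2) b(1)
        best_reduced_tie_broken[OF \<open>finite P\<close> l] best_reduced_tie_broken[OF \<open>finite P\<close> r]
      unfolding a(2) b(2) by (metis order.strict_trans)
  qed
  then show ?thesis
    unfolding max_step_def using a b
    by (intro Max0_ge finite_steps) auto
qed

text \<open>Vertices are undominated, so along the hull the values increase with the costs.\<close>

lemma max_step_nonneg: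
  assumes "finite P"
  shows "0 \<le> max_step (hull_list P)"
  unfolding max_step_def
proof (rule Max0_nonneg)
  fix x assume "x \<in> {snd (hull_list P ! (k + 1)) - snd (hull_list P ! k) | k. k + 1 < length (hull_list P)}"
  then obtain k where k: "k + 1 < length (hull_list P)"
    and x: "x = snd (hull_list P ! (k + 1)) - snd (hull_list P ! k)"
    by auto
  let ?p = "hull_list P ! k" and ?q = "hull_list P ! (k + 1)"
  have lt: "fst ?p < fst ?q"
    using hull_list(2)[OF assms] k by (simp add: sorted_wrt_iff_nth_less)
  have "?p \<in> set (hull_list P)" "?q \<in> set (hull_list P)"
    using k by (auto intro: nth_mem)
  then have "?p \<in> P" "?q \<in> undominated P"
    using hull_list(1)[OF assms] hull_vertices_subset[of P] by (auto simp: undominated_def)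
  then have "snd ?p \<le> snd ?q"
    using undominatedD[of ?q P ?p] lt by force
  then show "0 \<le> x"
    using x by simp
qed (rule finite_steps)

section \<open>The Lagrangian bound and its rounding\<close>

definition lagrangian_bound ::
  "'i set \<Rightarrow> ('i \<Rightarrow> (real \<times> real) set) \<Rightarrow> real \<Rightarrow> real \<Rightarrow> real" where
  "lagrangian_bound I P C \<mu> = \<mu> * C + (\<Sum>i \<in> I. best_reduced \<mu> (P i))"

text \<open>
  The derivative of the bound in the direction \<open>d\<close> is \<open>d\<close> times the capacity that the maximizers
  tie-broken by \<open>d\<close> leave unused; it is nonnegative at a minimum.
\<close>

lemma lagrangian_directional_minimum:
  assumes "finite I" "\<And>i. i \<in> I \<Longrightarrow> finite (P i)"
    and l: "\<And>i. i \<in> I \<Longrightarrow> tie_broken_maximizer d \<mu> (P i) (l i)"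
    and minimum: "\<forall>\<^sub>F \<epsilon> in at_right 0.
      lagrangian_bound I P C \<mu> \<le> lagrangian_bound I P C (\<mu> + d * \<epsilon>)"
  shows "0 \<le> d * (C - (\<Sum>i \<in> I. fst (l i)))"
proof -
  have "\<forall>\<^sub>F \<epsilon> in at_right 0. \<forall>i \<in> I.
      best_reduced (\<mu> + d * \<epsilon>) (P i) = best_reduced \<mu> (P i) - d * \<epsilon> * fst (l i)"
    using assms(2) l by (intro eventually_ball_finite[OF assms(1)] ballI eventually_best_reduced)
  with minimum eventually_at_right_less[of "0::real"]
  have "\<forall>\<^sub>F \<epsilon> in at_right (0::real). 0 \<le> d * (C - (\<Sum>i \<in> I. fst (l i)))"
  proof eventually_elim
    case (elim \<epsilon>)
    have "lagrangian_bound I P C (\<mu> + d * \<epsilon>)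
        = (\<mu> + d * \<epsilon>) * C + (\<Sum>i \<in> I. best_reduced \<mu> (P i) - d * \<epsilon> * fst (l i))"
      using elim(3) by (simp add: lagrangian_bound_def)
    also have "\<dots> = lagrangian_bound I P C \<mu> + \<epsilon> * (d * (C - (\<Sum>i \<in> I. fst (l i))))"
      by (simp add: lagrangian_bound_def sum_subtractf sum_distrib_left algebra_simps)
    finally show ?case
      using elim(1,2) by (simp add: zero_le_mult_iff)
  qed
  then show ?thesis
    by (auto dest: eventually_happens)
qed

text \<open>
  This lets the bound be minimized over a compact interval of multipliers: if the minimum is at a
  large right end, then the maximizers there cost nothing and fit into any nonnegative capacity.
\<close>

lemma large_multiplier_maximizers_cost_zero:
  assumes "finite P" "z \<in> P" "fst z = 0" "\<And>p. p \<in> P \<Longrightarrow> 0 \<le> fst p"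
  shows "\<forall>\<^sub>F \<mu> in at_top. \<forall>d l. tie_broken_maximizer d \<mu> P l \<longrightarrow> fst l = 0"
proof -
  have "\<forall>\<^sub>F \<mu> in at_top. \<forall>p \<in> P. 0 < fst p \<longrightarrow> reduced_value \<mu> p < reduced_value \<mu> z"
  proof (intro eventually_ball_finite[OF assms(1)] ballI)
    fix p
    show "\<forall>\<^sub>F \<mu> in at_top. 0 < fst p \<longrightarrow> reduced_value \<mu> p < reduced_value \<mu> z"
      using eventually_gt_at_top[of "(snd p - snd z) / fst p"]
      by eventually_elim (auto simp: reduced_value_def assms(3) field_simps)
  qed
  then show ?thesis
  proof eventually_elim
    case (elim \<mu>)
    show ?case
    proof (intro allI impI)
      fix d l assume l: "tie_broken_maximizer d \<mu> P l"
      then have "l \<in> P" "reduced_value \<mu> z \<le> reduced_value \<mu> l"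
        using reduced_value_le_best[OF assms(1,2), of \<mu>] best_reduced_tie_broken[OF assms(1) l]
        by (auto simp: tie_broken_maximizer_def)
      then show "fst l = 0"
        using elim assms(4)[of l] by force
    qed
  qed
qed

text \<open>
  The multiplier minimizes the bound.  At \<open>\<mu> = 0\<close> there is no left derivative, and the total cost of
  the \<open>r i\<close> may then stay below the capacity.
\<close>

lemma balanced_multiplier_exists:
  assumes "finite I" "\<And>i. i \<in> I \<Longrightarrow> finite (P i)"
    and "\<And>i. i \<in> I \<Longrightarrow> z i \<in> P i" "\<And>i. i \<in> I \<Longrightarrow> fst (z i) = 0"
    and "\<And>i p. i \<in> I \<Longrightarrow> p \<in> P i \<Longrightarrow> 0 \<le> fst p"
    and "0 \<le> C"
  obtains \<mu> l r where "0 \<le> \<mu>"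
    and "\<And>i. i \<in> I \<Longrightarrow> tie_broken_maximizer 1 \<mu> (P i) (l i)"
    and "\<And>i. i \<in> I \<Longrightarrow> tie_broken_maximizer (- 1) \<mu> (P i) (r i)"
    and "(\<Sum>i \<in> I. fst (l i)) \<le> C"
    and "0 < \<mu> \<Longrightarrow> C \<le> (\<Sum>i \<in> I. fst (r i))"
proof -
  let ?L = "lagrangian_bound I P C"
  have "\<forall>\<^sub>F \<mu> in at_top. \<forall>i \<in> I. \<forall>d l. tie_broken_maximizer d \<mu> (P i) l \<longrightarrow> fst l = 0"
  proof (intro eventually_ball_finite[OF assms(1)] ballI)
    fix i assume "i \<in> I"
    then show "\<forall>\<^sub>F \<mu> in at_top. \<forall>d l. tie_broken_maximizer d \<mu> (P i) l \<longrightarrow> fst l = 0"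
      using assms(2-5) by (intro large_multiplier_maximizers_cost_zero[of "P i" "z i"])
  qed
  from eventually_happens[OF eventually_conj[OF this eventually_gt_at_top[of 0]]]
  obtain M :: real where M: "0 < M"
    and free: "\<And>i d l. i \<in> I \<Longrightarrow> tie_broken_maximizer d M (P i) l \<Longrightarrow> fst l = 0"
    by (metis trivial_limit_at_top_linorder)
  have "continuous_on {0..M} ?L"
    unfolding lagrangian_bound_def using assms(2,3)
    by (intro continuous_intros continuous_on_best_reduced) blast+
  then obtain \<mu> where \<mu>: "0 \<le> \<mu>" "\<mu> \<le> M" and min: "\<And>y. 0 \<le> y \<Longrightarrow> y \<le> M \<Longrightarrow> ?L \<mu> \<le> ?L y"
    using continuous_attains_inf[of "{0..M}" ?L] M by auto
  have "\<exists>l. tie_broken_maximizer d \<mu> (P i) l" if "i \<in> I" "d \<noteq> 0" for i d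
    using assms(2,3) that by (intro tie_broken_maximizer_exists) auto
  then have "\<forall>i \<in> I. \<exists>l. tie_broken_maximizer 1 \<mu> (P i) l"
    "\<forall>i \<in> I. \<exists>r. tie_broken_maximizer (- 1) \<mu> (P i) r"
    by simp_all
  then obtain l r where l: "\<And>i. i \<in> I \<Longrightarrow> tie_broken_maximizer 1 \<mu> (P i) (l i)"
    and r: "\<And>i. i \<in> I \<Longrightarrow> tie_broken_maximizer (- 1) \<mu> (P i) (r i)"
    by metis
  show ?thesis
  proof (rule that[OF \<mu>(1) l r])
    show "(\<Sum>i \<in> I. fst (l i)) \<le> C"
    proof (cases "\<mu> = M")
      \<comment> \<open>At the right end of the interval minimality says nothing about larger multipliers.\<close>
      case True
      then have "(\<Sum>i \<in> I. fst (l i)) = 0"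
        using free l by (intro sum.neutral) blast
      then show ?thesis
        using \<open>0 \<le> C\<close> by simp
    next
      case False
      then have "0 < M - \<mu>"
        using \<mu> by simp
      then have "\<forall>\<^sub>F \<epsilon> in at_right 0. \<epsilon> < M - \<mu>"
        by (rule order_tendstoD(2)[OF tendsto_ident_at])
      then have "\<forall>\<^sub>F \<epsilon> in at_right 0. ?L \<mu> \<le> ?L (\<mu> + 1 * \<epsilon>)"
        using eventually_at_right_less[of "0::real"]
        by eventually_elim (use \<mu> min in auto)
      from lagrangian_directional_minimum[OF assms(1,2) l this] show ?thesis
        by simp
    qed
    show "C \<le> (\<Sum>i \<in> I. fst (r i))" if "0 < \<mu>"
    proof -
      have "\<forall>\<^sub>F \<epsilon> in at_right 0. \<epsilon> < \<mu>"
        using that by (rule order_tendstoD(2)[OF tendsto_ident_at])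
      then have "\<forall>\<^sub>F \<epsilon> in at_right 0. ?L \<mu> \<le> ?L (\<mu> + (- 1) * \<epsilon>)"
        using eventually_at_right_less[of "0::real"]
        by eventually_elim (use \<mu> min in auto)
      from lagrangian_directional_minimum[OF assms(1,2) r this] show ?thesis
        by simp
    qed
  qed
qed

lemma critical_insertion:
  assumes "finite I" "Q {}" "\<not> Q I"
  obtains J k where "J \<subseteq> I" "k \<in> I - J" "Q J" "\<not> Q (insert k J)"
proof -
  have "finite {J. J \<subseteq> I \<and> Q J}" "{J. J \<subseteq> I \<and> Q J} \<noteq> {}"
    using assms by auto
  from finite_has_maximal[OF this] obtain J where J: "J \<subseteq> I" "Q J"
    and max: "\<forall>J'. J' \<subseteq> I \<and> Q J' \<longrightarrow> J \<subseteq> J' \<longrightarrow> J = J'"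
    unfolding Bex_def Ball_def mem_Collect_eq by blast
  have "J \<noteq> I"
    using J(2) assms(3) by auto
  then obtain k where "k \<in> I - J"
    using J(1) by blast
  then show ?thesis
    using that[of J k] J max by (metis DiffD1 DiffD2 insertI1 insert_subset subset_insertI)
qed

text \<open>
  Every mixture of the \<open>l i\<close> and \<open>r i\<close> consists of maximizers, so the bound exceeds its value by \<open>\<mu>\<close>
  times the unused capacity (the fact \<open>bound\<close>).  At the critical exchange of item \<open>k\<close> the unused
  capacity is less than the cost difference of \<open>l k\<close> and \<open>r k\<close>.
\<close>

lemma lagrangian_rounding:
  assumes "finite I" "\<And>i. i \<in> I \<Longrightarrow> finite (P i)"
    and "\<And>i. i \<in> I \<Longrightarrow> z i \<in> P i" "\<And>i. i \<in> I \<Longrightarrow> fst (z i) = 0"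
    and "\<And>i p. i \<in> I \<Longrightarrow> p \<in> P i \<Longrightarrow> 0 \<le> fst p"
    and "0 \<le> C"
    and "0 \<le> G" and G: "\<And>i. i \<in> I \<Longrightarrow> max_step (hull_list (P i)) \<le> G"
  obtains \<mu> q where "0 \<le> \<mu>" "\<And>i. i \<in> I \<Longrightarrow> q i \<in> P i"
    and "(\<Sum>i \<in> I. fst (q i)) \<le> C"
    and "lagrangian_bound I P C \<mu> \<le> (\<Sum>i \<in> I. snd (q i)) + G"
proof -
  obtain \<mu> l r where \<mu>: "0 \<le> \<mu>"
    and l: "\<And>i. i \<in> I \<Longrightarrow> tie_broken_maximizer 1 \<mu> (P i) (l i)"
    and r: "\<And>i. i \<in> I \<Longrightarrow> tie_broken_maximizer (- 1) \<mu> (P i) (r i)"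
    and l_le: "(\<Sum>i \<in> I. fst (l i)) \<le> C"
    and r_ge: "0 < \<mu> \<Longrightarrow> C \<le> (\<Sum>i \<in> I. fst (r i))"
    by (rule balanced_multiplier_exists[of I P z C, OF assms(1-6)]) blast+
  define mix where "mix J i = (if i \<in> J then r i else l i)" for J i
  have mix_in: "mix J i \<in> P i" if "i \<in> I" for J i
    using l r that by (auto simp: mix_def tie_broken_maximizer_def)
  have bound: "lagrangian_bound I P C \<mu>
      = (\<Sum>i \<in> I. snd (mix J i)) + \<mu> * (C - (\<Sum>i \<in> I. fst (mix J i)))" for J
  proof -
    have "best_reduced \<mu> (P i) = snd (mix J i) - \<mu> * fst (mix J i)" if "i \<in> I" for i
      using best_reduced_tie_broken[OF assms(2) l] best_reduced_tie_broken[OF assms(2) r] that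
      by (simp add: mix_def reduced_value_def)
    then have "lagrangian_bound I P C \<mu>
        = \<mu> * C + (\<Sum>i \<in> I. snd (mix J i) - \<mu> * fst (mix J i))"
      by (simp add: lagrangian_bound_def)
    then show ?thesis
      by (simp add: sum_subtractf sum_distrib_left algebra_simps)
  qed
  show ?thesis
  proof (cases "(\<Sum>i \<in> I. fst (mix I i)) \<le> C")
    case True
    have "(\<Sum>i \<in> I. fst (mix I i)) = (\<Sum>i \<in> I. fst (r i))"
      by (simp add: mix_def)
    then have "\<mu> * (C - (\<Sum>i \<in> I. fst (mix I i))) = 0"
      using True r_ge \<mu> by (cases "\<mu> = 0") auto
    then have "lagrangian_bound I P C \<mu> \<le> (\<Sum>i \<in> I. snd (mix I i)) + G"
      using bound[of I] \<open>0 \<le> G\<close> by linarith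
    then show ?thesis
      using that[OF \<mu> mix_in True] by blast
  next
    case False
    have "(\<Sum>i \<in> I. fst (mix {} i)) \<le> C"
      using l_le by (simp add: mix_def)
    with False obtain J k where k: "k \<in> I - J"
      and J: "(\<Sum>i \<in> I. fst (mix J i)) \<le> C" and "\<not> (\<Sum>i \<in> I. fst (mix (insert k J) i)) \<le> C"
      using critical_insertion[OF assms(1), of "\<lambda>J. (\<Sum>i \<in> I. fst (mix J i)) \<le> C"] by blast
    moreover have "(\<Sum>i \<in> I. fst (mix (insert k J) i))
        = (\<Sum>i \<in> I. fst (mix J i)) + (fst (r k) - fst (l k))"
    proof -
      have "(\<Sum>i \<in> I. fst (mix (insert k J) i))
          = fst (mix (insert k J) k) + (\<Sum>i \<in> I - {k}. fst (mix (insert k J) i))"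
        using k by (intro sum.remove[OF assms(1)]) simp
      also have "(\<Sum>i \<in> I - {k}. fst (mix (insert k J) i)) = (\<Sum>i \<in> I - {k}. fst (mix J i))"
        by (intro sum.cong) (auto simp: mix_def)
      also have "\<dots> = (\<Sum>i \<in> I. fst (mix J i)) - fst (mix J k)"
        using k assms(1) by (subst sum.remove[of I k]) auto
      finally show ?thesis
        using k by (simp add: mix_def)
    qed
    ultimately have residual: "C - (\<Sum>i \<in> I. fst (mix J i)) < fst (r k) - fst (l k)"
      by simp
    have "\<mu> * (C - (\<Sum>i \<in> I. fst (mix J i))) \<le> G"
    proof (cases "\<mu> = 0")
      case False
      have "k \<in> I"
        using k by simp
      have "\<mu> * (C - (\<Sum>i \<in> I. fst (mix J i))) \<le> \<mu> * (fst (r k) - fst (l k))"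
        using residual \<mu> by (intro mult_left_mono) auto
      also have "\<dots> = snd (r k) - snd (l k)"
        using best_reduced_tie_broken[OF assms(2) l] best_reduced_tie_broken[OF assms(2) r] \<open>k \<in> I\<close>
        by (simp add: reduced_value_def algebra_simps)
      also have "\<dots> \<le> max_step (hull_list (P k))"
        using tie_broken_maximizers_step[OF assms(2) _ l r] \<open>k \<in> I\<close> False \<mu> residual J by simp
      also have "\<dots> \<le> G"
        using G \<open>k \<in> I\<close> .
      finally show ?thesis .
    qed (use \<open>0 \<le> G\<close> in simp)
    then show ?thesis
      using that[OF \<mu> mix_in J] bound[of J] by simp
  qed
qed

section \<open>The pricing problem\<close>

lemma finite_admissible_idx: "finite (admissible_idx D i)"
  by (simp add: admissible_idx_def)

lemma finite_item_points: "finite (item_points D \<theta> js i)"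
  by (simp add: item_points_def finite_admissible_idx)

text \<open>
  Weak duality: for each item, a convex combination of reduced values is at most the best one, and
  \<open>\<mu>\<close> times the total cost is at most \<open>\<mu>\<close> times the capacity.
\<close>

lemma lp_objective_le_lagrangian_bound:
  assumes "lp_feasible D \<theta> js z" "0 \<le> \<mu>"
  shows "lp_objective D z
    \<le> lagrangian_bound {1..items D} (item_points D \<theta> js) (capacity D \<theta> js) \<mu>"
proof -
  let ?I = "{1..items D}" and ?A = "admissible_idx D"
  let ?cost = "\<Sum>i \<in> ?I. \<Sum>j \<in> ?A i. cost D \<theta> js i j * z i j"
  have item: "(\<Sum>j \<in> ?A i. (opt_value D i j - \<mu> * cost D \<theta> js i j) * z i j)
      \<le> best_reduced \<mu> (item_points D \<theta> js i)" if i: "i \<in> ?I" for i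
  proof -
    have "(\<Sum>j \<in> ?A i. (opt_value D i j - \<mu> * cost D \<theta> js i j) * z i j)
        \<le> (\<Sum>j \<in> ?A i. best_reduced \<mu> (item_points D \<theta> js i) * z i j)"
    proof (rule sum_mono, rule mult_right_mono)
      fix j assume j: "j \<in> ?A i"
      then show "opt_value D i j - \<mu> * cost D \<theta> js i j \<le> best_reduced \<mu> (item_points D \<theta> js i)"
        using reduced_value_le_best[OF finite_item_points,
            of "(cost D \<theta> js i j, opt_value D i j)" D \<theta> js i \<mu>]
        by (auto simp: reduced_value_def item_points_def)
      show "0 \<le> z i j"
        using assms(1) i j by (auto simp: lp_feasible_def)
    qed
    also have "\<dots> = best_reduced \<mu> (item_points D \<theta> js i)"
      using assms(1) i by (simp add: lp_feasible_def flip: sum_distrib_left)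
    finally show ?thesis .
  qed
  have "lp_objective D z = (\<Sum>i \<in> ?I. \<Sum>j \<in> ?A i. (opt_value D i j - \<mu> * cost D \<theta> js i j) * z i j)
      + \<mu> * ?cost"
    by (simp add: lp_objective_def sum_distrib_left sum_subtractf algebra_simps)
  also have "\<dots> \<le> (\<Sum>i \<in> ?I. best_reduced \<mu> (item_points D \<theta> js i)) + \<mu> * capacity D \<theta> js"
    using assms by (intro add_mono sum_mono item mult_left_mono) (auto simp: lp_feasible_def)
  finally show ?thesis
    by (simp add: lagrangian_bound_def)
qed

lemma ip_feasible_as_lp:
  assumes "ip_feasible D \<theta> js ch"
  shows "\<exists>z. lp_feasible D \<theta> js z \<and> lp_objective D z = ip_objective D ch"
proof -
  define z :: "nat \<Rightarrow> nat \<Rightarrow> real" where "z i j = (if ch i = j then 1 else 0)" for i j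
  have collapse: "(\<Sum>j \<in> admissible_idx D i. f j * z i j) = f (ch i)"
    if "i \<in> {1..items D}" for f and i
    using assms that finite_admissible_idx by (auto simp: z_def ip_feasible_def if_distrib cong: if_cong)
  have "lp_feasible D \<theta> js z"
    using assms collapse[where f = "\<lambda>_. 1"] collapse
    by (auto simp: lp_feasible_def ip_feasible_def z_def)
  moreover have "lp_objective D z = ip_objective D ch"
    using collapse by (auto simp: lp_objective_def ip_objective_def)
  ultimately show ?thesis
    by blast
qed

lemma slack_maximizers_in_admissible_idx:
  assumes "slack_maximizers D \<theta> js" "i \<in> {1..items D}"
  shows "js i \<in> admissible_idx D i"
  using assms by (auto simp: slack_maximizers_def is_arg_max_def)

lemma cost_nonneg:
  assumes "slack_maximizers D \<theta> js" "i \<in> {1..items D}" "j \<in> admissible_idx D i"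
  shows "0 \<le> cost D \<theta> js i j"
  using assms by (force simp: slack_maximizers_def is_arg_max_def cost_def)

lemma max_step_le_max_value_gap:
  assumes "i \<in> {1..items D}"
  shows "max_step (hull_list (item_points D \<theta> js i)) \<le> max_value_gap D \<theta> js"
  unfolding max_value_gap_def using assms by (intro Max0_ge) auto

lemma max_value_gap_nonneg: "0 \<le> max_value_gap D \<theta> js"
  unfolding max_value_gap_def
  by (rule Max0_nonneg) (auto intro: max_step_nonneg finite_item_points)

theorem proposition9:
  fixes D :: pricing_data and \<theta> :: real and js :: "nat \<Rightarrow> nat"
  assumes "valid_data D"
    and "\<theta> \<in> breakpoints D"
    and "slack_maximizers D \<theta> js"
    and "capacity D \<theta> js \<ge> 0"
  shows "0 \<le> opt_lp D \<theta> js - opt_ip D \<theta> js \<and>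
         opt_lp D \<theta> js - opt_ip D \<theta> js \<le> max_value_gap D \<theta> js"
proof -
  let ?I = "{1..items D}" and ?P = "item_points D \<theta> js" and ?C = "capacity D \<theta> js"
  let ?IP = "{ip_objective D ch | ch. ip_feasible D \<theta> js ch}"
  let ?LP = "{lp_objective D z | z. lp_feasible D \<theta> js z}"
  \<comment> \<open>The slack maximizer \<open>js i\<close> is the free option of item \<open>i\<close>.\<close>
  obtain \<mu> q where \<mu>: "0 \<le> \<mu>" and q: "\<And>i. i \<in> ?I \<Longrightarrow> q i \<in> ?P i"
    and q_cost: "(\<Sum>i \<in> ?I. fst (q i)) \<le> ?C"
    and q_value: "lagrangian_bound ?I ?P ?C \<mu> \<le> (\<Sum>i \<in> ?I. snd (q i)) + max_value_gap D \<theta> js"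
  proof (rule lagrangian_rounding[where I = ?I and P = ?P and C = ?C
        and z = "\<lambda>i. (cost D \<theta> js i (js i), opt_value D i (js i))"
        and G = "max_value_gap D \<theta> js"])
    show "0 \<le> fst p" if "i \<in> ?I" "p \<in> ?P i" for i p
      using that cost_nonneg[OF assms(3)] by (auto simp: item_points_def)
  qed (use assms(4) slack_maximizers_in_admissible_idx[OF assms(3)] in
      \<open>auto simp: item_points_def cost_def finite_admissible_idx max_value_gap_nonneg
        intro!: max_step_le_max_value_gap[unfolded item_points_def cost_def]\<close>)
  have "\<exists>j. j \<in> admissible_idx D i \<and> q i = (cost D \<theta> js i j, opt_value D i j)" if "i \<in> ?I" for i
    using q[OF that] by (auto simp: item_points_def)
  then obtain ch where ch: "\<And>i. i \<in> ?I \<Longrightarrow>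
      ch i \<in> admissible_idx D i \<and> q i = (cost D \<theta> js i (ch i), opt_value D i (ch i))"
    by metis
  then have "ip_feasible D \<theta> js ch"
    using q_cost by (simp add: ip_feasible_def)
  then have ch_in: "ip_objective D ch \<in> ?IP"
    by blast
  have ch_value: "(\<Sum>i \<in> ?I. snd (q i)) = ip_objective D ch"
    using ch by (simp add: ip_objective_def)
  have sub: "?IP \<subseteq> ?LP"
    using ip_feasible_as_lp by (smt (verit) Collect_mono_iff)
  have LP_le: "x \<le> lagrangian_bound ?I ?P ?C \<mu>" if "x \<in> ?LP" for x
    using that lp_objective_le_lagrangian_bound[OF _ \<mu>] by blast
  then have bdd: "bdd_above ?LP"
    by (rule bdd_aboveI)
  have "opt_ip D \<theta> js \<le> opt_lp D \<theta> js"
    unfolding opt_ip_def opt_lp_def using ch_in bdd sub by (intro cSup_subset_mono) auto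
  moreover have "opt_lp D \<theta> js \<le> lagrangian_bound ?I ?P ?C \<mu>"
    unfolding opt_lp_def using ch_in sub LP_le by (intro cSup_least) auto
  moreover have "ip_objective D ch \<le> opt_ip D \<theta> js"
    unfolding opt_ip_def using ch_in bdd_above_mono[OF bdd sub] by (rule cSup_upper)
  ultimately show ?thesis
    using q_value ch_value by simp
qed

end
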